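(* (1) Every filter-based semantics is $+$-compatible. (2) Every order-based semantics is $+$-decomposable but not $+$-composable. (3) For every walk-based $+$-compatible semantics $S$ there exists a filter-based semantics $S'$ such that for every database $D$, every regular expression $R$ and every walk $w$ of positive length: $w\in S(D,R)$ if and only if $w\in S'(D,R)$.
   Context: Fix pairwise disjoint countably infinite sets $\mathbb V$ (vertex identifiers), $\mathbb E$ (edge identifiers), $\mathbb L$ (labels). Regular expressions are given by $R ::= \varepsilon \mid a \mid R^* \mid R\cdot R\mid R+R$ with $a\in\mathbb L$ (there is no expression for the empty language); $L(R)$ is the denoted language. A walk is a finite nonempty alternating sequence $w=(v_0,e_1,v_1,\dots,e_k,v_k)$ with $v_i\in\mathbb V$, $e_i\in\mathbb E$; its length is $k$ and its endpoints are the pair $(v_0,v_k)$. $\mathsf{Walks}$ is the set of all walks (independently of any database). A database $D=(L_D,V_D,E_D,\mathsf{Src}_D,\mathsf{Tgt}_D,\mathsf{Lbl}_D)$ consists of finite sets $L_D\subset\mathbb L$, $V_D\subset\mathbb V$, $E_D\subset\mathbb E$ and functions $\mathsf{Src}_D,\mathsf{Tgt}_D:E_D\to V_D$, $\mathsf{Lbl}_D:E_D\to L_D$. $\mathsf{Walks}(D)$ is the set of walks $(v_0,e_1,\dots,e_k,v_k)$ with all $v_i\in V_D$, $e_i\in E_D$, $\mathsf{Src}_D(e_i)=v_{i-1}$ and $\mathsf{Tgt}_D(e_i)=v_i$; the label $\mathsf{Lbl}_D(w)$ of such a walk is the word $\mathsf{Lbl}_D(e_1)\cdots\mathsf{Lbl}_D(e_k)$.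 $\mathsf{Matches}(D,R)=\{w\in\mathsf{Walks}(D): \mathsf{Lbl}_D(w)\in L(R)\}$, and $\mathsf{Matches}(D,R,s,t)$ is the set of those $w\in \mathsf{Matches}(D,R)$ with endpoints $(s,t)$. A semantics $S$ is a function mapping every database $D$ and regular expression $R$ to a finite subset $S(D,R)$ of $\mathsf{Matches}(D,R)$. $S$ is walk-based if there is a function $r:2^{\mathsf{Walks}}\to 2^{\mathsf{Walks}}$ with $S(D,R)=r(\mathsf{Matches}(D,R))$ for all $D,R$. $S$ is filter-based if there is a function $f:\mathsf{Walks}\to\{\top,\bot\}$ with $S(D,R)=\{w\in\mathsf{Matches}(D,R): f(w)=\top\}$ for all $D,R$. A partial order $\preceq$ on $\mathsf{Walks}$ is suitable if for every database $D$ its restriction to $\mathsf{Walks}(D)$ is a well-partial-order (every infinite sequence $x_1,x_2,\dots$ has $i<j$ with $x_i\preceq x_j$). $S$ is order-based if there is a suitable order $\preceq$ with $S(D,R)=\bigcup_{s,t\in V_D}\min_\preceq \mathsf{Matches}(D,R,s,t)$ for all $D,R$, where $\min_\preceq X$ is the set of $\preceq$-minimal elements of $X$. $S$ is $+$-composable if $S(D,R+R')\supseteq S(D,R)\cup S(D,R')$ for all $D,R,R'$; $+$-decomposable if $S(D,R+R')\subseteq S(D,R)\cup S(D,R')$ for all $D,R,R'$; $+$-compatible if both hold. *)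

theory Defs
  imports Main "HOL-Library.FuncSet" "HOL-Library.Countable" "HOL-Library.Infinite_Typeclass"
begin

text \<open>Vertex identifiers, edge identifiers and labels are three type parameters; the intended
  instances are of class \<open>{countable, infinite}\<close>.\<close>

datatype 'l rexp =
    Epsilon
  | Atom 'l
  | Star "'l rexp"
  | Times "'l rexp" "'l rexp"
  | Plus "'l rexp" "'l rexp"

fun lang :: "'l rexp \<Rightarrow> 'l list set" where
  "lang Epsilon = {[]}"
| "lang (Atom a) = {[a]}"
| "lang (Star R) = concat ` lists (lang R)"
| "lang (Times R R') = {u @ v |u v. u \<in> lang R \<and> v \<in> lang R'}"
| "lang (Plus R R') = lang R \<union> lang R'"

text \<open>The alternating sequence \<open>v\<^sub>0, e\<^sub>1, v\<^sub>1, \<dots>, e\<^sub>k, v\<^sub>k\<close> is represented by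
  \<open>(v\<^sub>0, [(e\<^sub>1, v\<^sub>1), \<dots>, (e\<^sub>k, v\<^sub>k)])\<close>. Every value of this type is such a sequence and vice versa,
  so the set of all walks is \<open>UNIV\<close>.\<close>

type_synonym ('v, 'e) walk = "'v \<times> ('e \<times> 'v) list"

definition walk_verts :: "('v, 'e) walk \<Rightarrow> 'v list" where
  "walk_verts w = fst w # map snd (snd w)"

definition walk_edges :: "('v, 'e) walk \<Rightarrow> 'e list" where
  "walk_edges w = map fst (snd w)"

definition walk_length :: "('v, 'e) walk \<Rightarrow> nat" where
  "walk_length w = length (walk_edges w)"

definition endpoints :: "('v, 'e) walk \<Rightarrow> 'v \<times> 'v" where
  "endpoints w = (hd (walk_verts w), last (walk_verts w))"

record ('v, 'e, 'l) database =
  Labels :: "'l set"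
  Verts :: "'v set"
  Edges :: "'e set"
  Src :: "'e \<Rightarrow> 'v"
  Tgt :: "'e \<Rightarrow> 'v"
  Lbl :: "'e \<Rightarrow> 'l"

text \<open>The extensional function space makes \<open>Src\<close>, \<open>Tgt\<close> and \<open>Lbl\<close> functions with domain exactly
  \<open>Edges D\<close>: two databases are equal as records as soon as these functions agree on the edges.\<close>

definition is_database :: "('v, 'e, 'l) database \<Rightarrow> bool" where
  "is_database D \<longleftrightarrow>
     finite (Labels D) \<and> finite (Verts D) \<and> finite (Edges D) \<and>
     Src D \<in> Edges D \<rightarrow>\<^sub>E Verts D \<and>
     Tgt D \<in> Edges D \<rightarrow>\<^sub>E Verts D \<and>
     Lbl D \<in> Edges D \<rightarrow>\<^sub>E Labels D"

definition walks :: "('v, 'e, 'l) database \<Rightarrow> ('v, 'e) walk set" where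
  "walks D = {w. set (walk_verts w) \<subseteq> Verts D \<and> set (walk_edges w) \<subseteq> Edges D \<and>
     (\<forall>i < walk_length w. Src D (walk_edges w ! i) = walk_verts w ! i \<and>
                          Tgt D (walk_edges w ! i) = walk_verts w ! Suc i)}"

definition walk_label :: "('v, 'e, 'l) database \<Rightarrow> ('v, 'e) walk \<Rightarrow> 'l list" where
  "walk_label D w = map (Lbl D) (walk_edges w)"

definition matches :: "('v, 'e, 'l) database \<Rightarrow> 'l rexp \<Rightarrow> ('v, 'e) walk set" where
  "matches D R = {w \<in> walks D. walk_label D w \<in> lang R}"

definition matches_between ::
    "('v, 'e, 'l) database \<Rightarrow> 'l rexp \<Rightarrow> 'v \<Rightarrow> 'v \<Rightarrow> ('v, 'e) walk set" where
  "matches_between D R s t = {w \<in> matches D R. endpoints w = (s, t)}"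

text \<open>The values of a semantics on records that are not databases are irrelevant: all notions below
  quantify over databases only.\<close>

type_synonym ('v, 'e, 'l) semantics =
  "('v, 'e, 'l) database \<Rightarrow> 'l rexp \<Rightarrow> ('v, 'e) walk set"

definition is_semantics :: "('v, 'e, 'l) semantics \<Rightarrow> bool" where
  "is_semantics S \<longleftrightarrow>
     (\<forall>D R. is_database D \<longrightarrow> finite (S D R) \<and> S D R \<subseteq> matches D R)"

definition walk_based :: "('v, 'e, 'l) semantics \<Rightarrow> bool" where
  "walk_based S \<longleftrightarrow>
     (\<exists>r :: ('v, 'e) walk set \<Rightarrow> ('v, 'e) walk set.
        \<forall>D R. is_database D \<longrightarrow> S D R = r (matches D R))"

definition filter_based :: "('v, 'e, 'l) semantics \<Rightarrow> bool" where
  "filter_based S \<longleftrightarrow>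
     (\<exists>f :: ('v, 'e) walk \<Rightarrow> bool.
        \<forall>D R. is_database D \<longrightarrow> S D R = {w \<in> matches D R. f w})"

text \<open>Pairs \<open>(x, y) \<in> le\<close> stand for \<open>x \<preceq> y\<close>. Since \<open>le\<close> is a partial order on all walks, so is its
  restriction to \<open>walks D\<close>; only the condition on infinite sequences has to be added. The label
  type occurs only in the databases quantified over, hence the type token.\<close>

definition suitable :: "'l itself \<Rightarrow> ('v, 'e) walk rel \<Rightarrow> bool" where
  "suitable _ le \<longleftrightarrow>
     partial_order_on UNIV le \<and>
     (\<forall>D :: ('v, 'e, 'l) database. is_database D \<longrightarrow>
        (\<forall>x :: nat \<Rightarrow> ('v, 'e) walk. range x \<subseteq> walks D \<longrightarrow> (\<exists>i j. i < j \<and> (x i, x j) \<in> le)))"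

definition minimal_elements :: "'a rel \<Rightarrow> 'a set \<Rightarrow> 'a set" where
  "minimal_elements le X = {x \<in> X. \<forall>y \<in> X. (y, x) \<in> le \<longrightarrow> y = x}"

definition order_based :: "('v, 'e, 'l) semantics \<Rightarrow> bool" where
  "order_based S \<longleftrightarrow>
     (\<exists>le. suitable TYPE('l) le \<and>
        (\<forall>D R. is_database D \<longrightarrow>
           S D R = (\<Union>s \<in> Verts D. \<Union>t \<in> Verts D. minimal_elements le (matches_between D R s t))))"

definition plus_composable :: "('v, 'e, 'l) semantics \<Rightarrow> bool" where
  "plus_composable S \<longleftrightarrow>
     (\<forall>D R R'. is_database D \<longrightarrow> S D R \<union> S D R' \<subseteq> S D (Plus R R'))"

definition plus_decomposable :: "('v, 'e, 'l) semantics \<Rightarrow> bool" where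
  "plus_decomposable S \<longleftrightarrow>
     (\<forall>D R R'. is_database D \<longrightarrow> S D (Plus R R') \<subseteq> S D R \<union> S D R')"

definition plus_compatible :: "('v, 'e, 'l) semantics \<Rightarrow> bool" where
  "plus_compatible S \<longleftrightarrow> plus_composable S \<and> plus_decomposable S"

end

theory Submission
  imports Defs
begin

text \<open>
  (2) In a database with a single loop, well-partial-orderedness yields two comparable powers of the
  loop; the words spelled by them are expressions \<open>R\<close>, \<open>R'\<close> for which the larger power is selected
  by \<open>R'\<close> but not by \<open>R + R'\<close>.

  (3) The filter accepts \<open>w\<close> iff \<open>w \<in> r {w}\<close>. A regular language minus one word is
  regular or empty, so for a \<open>+\<close>-compatible walk-based \<open>S\<close>, membership of \<open>w\<close> in \<open>S D R\<close> depends
  on \<open>R\<close> only through \<open>w \<in> matches D R\<close>, and \<open>R\<close> may be replaced by the single word that labels \<open>w\<close>.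
  Relabel \<open>D\<close> so that distinct edges carry distinct labels: the matches of that word are still the
  matches of a finite language in the new database, and there \<open>w\<close>, having positive length, is the only
  match of its own label.
\<close>

section \<open>Regular languages, with the empty language\<close>

text \<open>No expression denotes the empty language, but derivatives and the removal of a word can
  produce it. Adjoining it gives closure under both.\<close>

definition regular :: "'l list set \<Rightarrow> bool" where
  "regular L \<longleftrightarrow> L = {} \<or> L \<in> range lang"

definition conc :: "'l list set \<Rightarrow> 'l list set \<Rightarrow> 'l list set" where
  "conc A B = {u @ v |u v. u \<in> A \<and> v \<in> B}"

text \<open>The Brzozowski derivative, that is, the left quotient by a letter.\<close>

definition deriv :: "'l \<Rightarrow> 'l list set \<Rightarrow> 'l list set" where
  "deriv a L = {v. a # v \<in> L}"

lemma regular_empty [simp]: "regular {}"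
  by (simp add: regular_def)

lemma regular_lang [simp]: "regular (lang R)"
  by (simp add: regular_def)

lemma regular_Un:
  assumes "regular A" "regular B"
  shows "regular (A \<union> B)"
  using assms unfolding regular_def by (auto simp flip: lang.simps(5))

lemma regular_UN:
  assumes "finite I" "\<And>i. i \<in> I \<Longrightarrow> regular (F i)"
  shows "regular (\<Union>i\<in>I. F i)"
  using assms by (induction I rule: finite_induct) (auto intro: regular_Un)

lemma regular_conc:
  assumes "regular A" "regular B"
  shows "regular (conc A B)"
proof (cases "A = {} \<or> B = {}")
  case True
  then show ?thesis by (auto simp: conc_def)
next
  case False
  then obtain R R' where "A = lang R" "B = lang R'"
    using assms by (auto simp: regular_def)
  then have "conc A B = lang (Times R R')"
    by (simp add: conc_def)
  then show ?thesis by (simp only: regular_lang)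
qed

lemma regular_singleton: "regular {u}"
proof (induction u)
  case Nil
  show ?case using regular_lang[of Epsilon] by simp
next
  case (Cons a u)
  have "{a # u} = conc (lang (Atom a)) {u}"
    by (auto simp: conc_def)
  then show ?case using regular_conc[OF regular_lang Cons.IH] by metis
qed

lemma lang_singletonE: obtains R where "lang R = {u}"
  using regular_singleton[of u] unfolding regular_def by force

lemma regular_finite:
  assumes "finite L"
  shows "regular L"
  using regular_UN[OF assms, of "\<lambda>u. {u}"] by (simp add: regular_singleton)

section \<open>Derivatives and the removal of a single word\<close>

lemma deriv_conc:
  "deriv a (conc A B) = conc (deriv a A) B \<union> (if [] \<in> A then deriv a B else {})"
  by (auto simp: deriv_def conc_def Cons_eq_append_conv)

lemma deriv_star:
  "deriv a (concat ` lists L) = conc (deriv a L) (concat ` lists L)"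
proof (intro equalityI subsetI)
  fix v assume "v \<in> deriv a (concat ` lists L)"
  then obtain ws where ws: "a # v = concat ws" "ws \<in> lists L"
    by (auto simp: deriv_def)
  then show "v \<in> conc (deriv a L) (concat ` lists L)"
  proof (induction ws)
    case Nil
    then show ?case by simp
  next
    case (Cons x ws)
    then show ?case
      by (cases x) (auto simp: conc_def deriv_def)
  qed
next
  fix v assume "v \<in> conc (deriv a L) (concat ` lists L)"
  then obtain x ws where "v = x @ concat ws" "a # x \<in> L" "ws \<in> lists L"
    by (auto simp: conc_def deriv_def)
  then have "a # v = concat ((a # x) # ws)" "(a # x) # ws \<in> lists L"
    by auto
  then show "v \<in> deriv a (concat ` lists L)"
    unfolding deriv_def by blast
qed

lemma regular_deriv_lang: "regular (deriv a (lang R))"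
proof (induction R)
  case Epsilon
  then show ?case by (simp add: deriv_def)
next
  case (Atom b)
  have "deriv a (lang (Atom b)) = (if a = b then {[]} else {})"
    by (auto simp: deriv_def)
  then show ?case by (simp add: regular_singleton)
next
  case (Star R)
  then show ?case
    using regular_conc[OF Star regular_lang[of "Star R"]] by (simp add: deriv_star)
next
  case (Times R R')
  have "lang (Times R R') = conc (lang R) (lang R')"
    by (simp add: conc_def)
  then show ?case
    using Times by (auto simp: deriv_conc intro!: regular_Un regular_conc)
next
  case (Plus R R')
  have "deriv a (lang (Plus R R')) = deriv a (lang R) \<union> deriv a (lang R')"
    by (auto simp: deriv_def)
  then show ?case using Plus by (simp add: regular_Un)
qed

lemma regular_deriv: "regular L \<Longrightarrow> regular (deriv a L)"
  by (auto simp: regular_def[of L] regular_deriv_lang) (simp add: deriv_def)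

text \<open>Labels may be infinite in number; restricting to those that occur makes splitting a
  language by first letter a finite union.\<close>

lemma lang_finite_alphabet: "\<exists>A. finite A \<and> lang R \<subseteq> lists A"
proof -
  have "finite (set_rexp R)"
    by (induction R) auto
  moreover have "lang R \<subseteq> lists (set_rexp R)"
    by (induction R) (auto simp: subset_iff in_lists_conv_set, blast+)
  ultimately show ?thesis by blast
qed

lemma regular_finite_alphabet: "regular L \<Longrightarrow> \<exists>A. finite A \<and> L \<subseteq> lists A"
  using lang_finite_alphabet by (auto simp: regular_def)

text \<open>Split the language by first letter. Removing \<open>a # u\<close> affects only the
  branch of \<open>a\<close>, where it removes \<open>u\<close> from the derivative, so induction on
  the word applies.\<close>

lemma regular_Diff_singleton:
  assumes "regular L"
  shows "regular (L - {u})"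
  using assms
proof (induction u arbitrary: L)
  case Nil
  obtain A where A: "finite A" "L \<subseteq> lists A"
    using regular_finite_alphabet[OF Nil] by blast
  have "L - {[]} = (\<Union>b\<in>A. conc {[b]} (deriv b L))"
  proof (intro set_eqI)
    fix v
    show "v \<in> L - {[]} \<longleftrightarrow> v \<in> (\<Union>b\<in>A. conc {[b]} (deriv b L))"
      using A(2) by (cases v) (auto simp: conc_def deriv_def)
  qed
  then show ?case
    using A(1) Nil by (simp add: regular_UN regular_conc regular_singleton regular_deriv)
next
  case (Cons a u)
  obtain A where A: "finite A" "L \<subseteq> lists A"
    using regular_finite_alphabet[OF Cons.prems] by blast
  let ?F = "\<lambda>b. conc {[b]} (if b = a then deriv a L - {u} else deriv b L)"
  \<comment> \<open>The empty word belongs to no branch, so it is kept by the separate term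
    \<open>L \<inter> {[]}\<close>.\<close>
  have "L - {a # u} = (L \<inter> {[]}) \<union> (\<Union>b\<in>A. ?F b)"
  proof (intro set_eqI)
    fix v
    show "v \<in> L - {a # u} \<longleftrightarrow> v \<in> (L \<inter> {[]}) \<union> (\<Union>b\<in>A. ?F b)"
      using A(2) by (cases v) (auto simp: conc_def deriv_def split: if_splits)
  qed
  moreover have "regular (\<Union>b\<in>A. ?F b)"
    using A(1) Cons by (intro regular_UN) (auto intro!: regular_conc regular_singleton regular_deriv)
  ultimately show ?case
    by (simp add: regular_Un regular_finite)
qed

section \<open>Filter-based and order-based semantics\<close>

lemma filter_based_plus_compatible:
  assumes "filter_based S"
  shows "plus_compatible S"
  using assms
  by (auto simp: filter_based_def plus_compatible_def plus_composable_def plus_decomposable_def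
      matches_def)

text \<open>An element minimal in a union is minimal in whichever part contains it.\<close>

lemma order_based_plus_decomposable:
  assumes "order_based S"
  shows "plus_decomposable S"
  unfolding plus_decomposable_def
proof (intro allI impI subsetI)
  fix D R R' w
  assume D: "is_database D" and w: "w \<in> S D (Plus R R')"
  obtain le where le: "\<And>R. S D R =
      (\<Union>s\<in>Verts D. \<Union>t\<in>Verts D. minimal_elements le (matches_between D R s t))"
    using assms D by (auto simp: order_based_def)
  have "matches_between D (Plus R R') s t = matches_between D R s t \<union> matches_between D R' s t"
    for s t
    by (auto simp: matches_between_def matches_def)
  then show "w \<in> S D R \<union> S D R'"
    using w unfolding le minimal_elements_def by (simp only: UN_iff Un_iff mem_Collect_eq) blast
qed

section \<open>Powers of a single loop\<close>

definition loop_database :: "'v \<Rightarrow> 'e \<Rightarrow> 'l \<Rightarrow> ('v, 'e, 'l) database" where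
  "loop_database v e a = \<lparr>Labels = {a}, Verts = {v}, Edges = {e},
     Src = (\<lambda>x\<in>{e}. v), Tgt = (\<lambda>x\<in>{e}. v), Lbl = (\<lambda>x\<in>{e}. a)\<rparr>"

lemma is_database_loop: "is_database (loop_database v e a)"
  by (auto simp: is_database_def loop_database_def)

definition loop_walk :: "'v \<Rightarrow> 'e \<Rightarrow> nat \<Rightarrow> ('v, 'e) walk" where
  "loop_walk v e n = (v, replicate n (e, v))"

lemma walks_loop: "walks (loop_database v e a) = range (loop_walk v e)"
proof (intro equalityI subsetI)
  fix w assume "w \<in> walks (loop_database v e a)"
  then have "fst w = v" "set (snd w) \<subseteq> {(e, v)}"
    by (auto simp: walks_def loop_database_def walk_verts_def walk_edges_def)
  then have "fst w = v" "snd w = replicate (length (snd w)) (e, v)"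
    by (blast intro: replicate_length_same[symmetric])+
  then have "w = loop_walk v e (length (snd w))"
    by (simp add: loop_walk_def prod_eq_iff)
  then show "w \<in> range (loop_walk v e)"
    by blast
next
  fix w assume "w \<in> range (loop_walk v e)"
  then obtain n where w: "w = loop_walk v e n" by blast
  have "v # replicate n v = replicate (Suc n) v"
    by simp
  then show "w \<in> walks (loop_database v e a)"
    by (auto simp: w walks_def loop_database_def loop_walk_def walk_verts_def walk_edges_def
        walk_length_def nth_Cons')
qed

lemma walk_label_loop: "walk_label (loop_database v e a) (loop_walk v e n) = replicate n a"
  by (simp add: walk_label_def loop_database_def loop_walk_def walk_edges_def)

lemma endpoints_loop: "endpoints (loop_walk v e n) = (v, v)"
  by (simp add: endpoints_def loop_walk_def walk_verts_def)

lemma matches_between_loop: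
  "matches_between (loop_database v e a) R v v = {loop_walk v e n |n. replicate n a \<in> lang R}"
  by (auto simp: matches_between_def matches_def walks_loop walk_label_loop endpoints_loop)

lemma order_based_not_plus_composable:
  fixes S :: "('v, 'e, 'l) semantics"
  assumes "order_based S"
  shows "\<not> plus_composable S"
proof
  assume comp: "plus_composable S"
  fix v :: 'v and e :: 'e and a :: 'l
  let ?D = "loop_database v e a" and ?w = "loop_walk v e"
  obtain le :: "('v, 'e) walk rel" where suit: "suitable TYPE('l) le"
    and S: "\<And>R. S ?D R =
      (\<Union>s\<in>Verts ?D. \<Union>t\<in>Verts ?D. minimal_elements le (matches_between ?D R s t))"
    using assms is_database_loop[of v e a] unfolding order_based_def by metis
  have S': "S ?D R = minimal_elements le {?w n |n. replicate n a \<in> lang R}" for R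
    unfolding S by (simp add: loop_database_def flip: matches_between_loop)
  have "range ?w \<subseteq> walks ?D"
    by (simp add: walks_loop)
  then obtain i j where ij: "i < j" "(?w i, ?w j) \<in> le"
    using suit is_database_loop[of v e a] unfolding suitable_def by metis
  obtain R where R: "lang R = {replicate i a}"
    by (rule lang_singletonE)
  obtain R' where R': "lang R' = {replicate j a}"
    by (rule lang_singletonE)
  \<comment> \<open>As the only match of \<open>R'\<close>, the larger power is trivially
    minimal.\<close>
  have "{?w n |n. replicate n a \<in> lang R'} = {?w j}"
    by (auto simp: R')
  then have "?w j \<in> S ?D R'"
    by (simp add: S' minimal_elements_def)
  then have "?w j \<in> S ?D (Plus R R')"
    using comp is_database_loop[of v e a] unfolding plus_composable_def by blast
  \<comment> \<open>The smaller power matches the sum through \<open>R\<close> and lies below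
    \<open>?w j\<close>, so minimality of \<open>?w j\<close> forces equality.\<close>
  then have "?w i = ?w j"
    using ij(2) unfolding S' minimal_elements_def by (fastforce simp: R)
  then show False
    using ij(1) by (simp add: loop_walk_def)
qed

section \<open>Walk-based semantics\<close>

text \<open>Sources and targets of the edges determine the vertices. Positive length is essential:
  walks of length 0 at different vertices have the same empty edge list.\<close>

lemma walk_eqI_edges:
  assumes x: "x \<in> walks D" and y: "y \<in> walks D"
    and edges: "walk_edges x = walk_edges y" "walk_length x > 0"
  shows "x = y"
proof -
  let ?V = "walk_verts"
  have len: "walk_length x = walk_length y"
    using edges by (simp add: walk_length_def)
  have lenV: "length (?V x) = Suc (walk_length x)" "length (?V y) = Suc (walk_length x)"
    using len by (simp_all add: walk_verts_def walk_length_def walk_edges_def)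
  have "?V x ! i = ?V y ! i" if "i < Suc (walk_length x)" for i
  proof (cases i)
    \<comment> \<open>The first vertex is the source of the first edge; every later one is the
      target of the edge before it.\<close>
    case 0
    then show ?thesis
      using x y edges len unfolding walks_def by (metis (mono_tags, lifting) mem_Collect_eq)
  next
    case (Suc k)
    then have "k < walk_length x" using that by simp
    then show ?thesis
      using x y edges len Suc unfolding walks_def by (metis (mono_tags, lifting) mem_Collect_eq)
  qed
  then have "?V x = ?V y"
    using lenV by (simp add: list_eq_iff_nth_eq)
  then show ?thesis
    using edges(1) unfolding walk_verts_def walk_edges_def
    by (metis list.inject prod.expand zip_map_fst_snd)
qed

section \<open>Relabelling the edges injectively\<close>

definition relabel :: "('e \<Rightarrow> 'l) \<Rightarrow> ('v, 'e, 'l) database \<Rightarrow> ('v, 'e, 'l) database" where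
  "relabel g D = D\<lparr>Labels := g ` Edges D, Lbl := restrict g (Edges D)\<rparr>"

lemma is_database_relabel: "is_database D \<Longrightarrow> is_database (relabel g D)"
  by (auto simp: is_database_def relabel_def)

lemma walks_relabel: "walks (relabel g D) = walks D"
  by (simp add: walks_def relabel_def)

lemma walk_label_relabel:
  "w \<in> walks D \<Longrightarrow> walk_label (relabel g D) w = map g (walk_edges w)"
  by (auto simp: walk_label_def relabel_def walks_def)

text \<open>With distinct labels, the word determines the edges, and these determine a walk of
  positive length.\<close>

lemma matches_relabel_singleton:
  assumes inj: "inj_on g (Edges D)" and w: "w \<in> walks D" "walk_length w > 0"
    and U: "lang U = {walk_label (relabel g D) w}"
  shows "matches (relabel g D) U = {w}"
proof -
  have "x = w" if x: "x \<in> walks D" and eq: "map g (walk_edges x) = map g (walk_edges w)" for x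
  proof -
    have "inj_on g (set (walk_edges x) \<union> set (walk_edges w))"
      using inj x w by (auto simp: walks_def intro: inj_on_subset)
    then have "walk_edges x = walk_edges w"
      using eq inj_on_map_eq_map by blast
    then show ?thesis
      using walk_eqI_edges[OF x w(1)] w(2) by (simp add: walk_length_def)
  qed
  then show ?thesis
    using w by (auto simp: matches_def U walks_relabel walk_label_relabel)
qed

lemma matches_cong: "lang R = lang R' \<Longrightarrow> matches D R = matches D R'"
  by (simp add: matches_def)

text \<open>This carries a match set over to the relabelled database, so that \<open>r\<close>
  yields the same value there. The new words that decode to \<open>u\<close> form a finite language,
  for which an expression exists.\<close>

lemma matches_relabel:
  assumes inj: "inj_on g (Edges D)" and fin: "finite (Edges D)"
    and U: "lang U = {u}" and ne: "matches D U \<noteq> {}"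
  obtains R where "matches (relabel g D) R = matches D U"
proof -
  \<comment> \<open>\<open>?h\<close> recovers the original label of an edge from its new
    one.\<close>
  let ?h = "Lbl D \<circ> inv_into (Edges D) g"
  let ?L = "{v. set v \<subseteq> g ` Edges D \<and> length v = length u \<and> map ?h v = u}"
  have "finite {v. set v \<subseteq> g ` Edges D \<and> length v = length u}"
    using fin by (intro finite_lists_length_eq) simp
  then have "regular ?L"
    by (intro regular_finite) (auto elim: rev_finite_subset)
  have label: "map g (walk_edges x) \<in> ?L \<longleftrightarrow> walk_label D x = u" if "x \<in> walks D" for x
  proof -
    have E: "set (walk_edges x) \<subseteq> Edges D"
      using that by (simp add: walks_def)
    then have "map ?h (map g (walk_edges x)) = walk_label D x"
      using inj by (auto simp: walk_label_def inv_into_f_f subset_iff)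
    then show ?thesis
      using E by (auto simp: walk_label_def)
  qed
  \<comment> \<open>A match of \<open>U\<close> excludes the empty language, the one case in which
    \<open>regular\<close> gives no expression.\<close>
  obtain x where "x \<in> walks D" "walk_label D x = u"
    using ne U by (auto simp: matches_def)
  then have "?L \<noteq> {}"
    using label by blast
  then obtain R where R: "lang R = ?L"
    using \<open>regular ?L\<close> unfolding regular_def by blast
  have "matches (relabel g D) R = matches D U"
    using label unfolding matches_def R U walks_relabel
    by (intro Collect_cong conj_cong refl) (simp only: walk_label_relabel singleton_iff)
  then show thesis by (rule that)
qed

section \<open>From compatibility to a filter\<close>

locale plus_compatible_walk_semantics =
  fixes S :: "('v, 'e, 'l) semantics" and r :: "('v, 'e) walk set \<Rightarrow> ('v, 'e) walk set"
  assumes semantics: "is_semantics S"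
    and compatible: "plus_compatible S"
    and walk_based: "is_database D \<Longrightarrow> S D R = r (matches D R)"
begin

text \<open>Adding to \<open>R\<close> a word it already has leaves the matches unchanged, so
  composability gives one direction. For the other, split that word off \<open>R\<close>:
  decomposability applies, and \<open>w\<close> does not match the rest.\<close>

lemma mem_singleton_iff:
  assumes D: "is_database D" and w: "w \<in> matches D R" and U: "lang U = {walk_label D w}"
  shows "w \<in> S D R \<longleftrightarrow> w \<in> S D U"
proof
  assume "w \<in> S D U"
  then have "w \<in> S D (Plus R U)"
    using compatible D unfolding plus_compatible_def plus_composable_def by blast
  moreover have "matches D (Plus R U) = matches D R"
    using w U by (intro matches_cong) (auto simp: matches_def)
  ultimately show "w \<in> S D R"
    by (simp add: walk_based D)
next
  assume wS: "w \<in> S D R"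
  show "w \<in> S D U"
  proof (cases "lang R = lang U")
    case True
    then show ?thesis
      using wS matches_cong[OF True, of D] by (simp add: walk_based D)
  next
    \<comment> \<open>Here the rest of \<open>lang R\<close> is nonempty and therefore denoted by an
      expression.\<close>
    case False
    then have "lang R - {walk_label D w} \<noteq> {}"
      using w U by (auto simp: matches_def)
    then obtain R' where R': "lang R' = lang R - {walk_label D w}"
      using regular_Diff_singleton[OF regular_lang] unfolding regular_def by (metis imageE)
    have "matches D (Plus U R') = matches D R"
      using w by (intro matches_cong) (auto simp: U R' matches_def)
    then have "w \<in> S D (Plus U R')"
      using wS by (simp add: walk_based D)
    then have "w \<in> S D U \<union> S D R'"
      using compatible D unfolding plus_compatible_def plus_decomposable_def by blast
    moreover have "w \<notin> S D R'"
      using semantics D R' by (auto simp: is_semantics_def matches_def)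
    ultimately show ?thesis by blast
  qed
qed

lemma mem_iff:
  assumes inf: "infinite (UNIV :: 'l set)"
    and D: "is_database D" and w: "w \<in> matches D R" "walk_length w > 0"
  shows "w \<in> S D R \<longleftrightarrow> w \<in> r {w}"
proof -
  have fin: "finite (Edges D)"
    using D by (simp add: is_database_def)
  \<comment> \<open>Finitely many edges can be given distinct labels because there are infinitely
    many labels.\<close>
  obtain B :: "'l set" where "finite B" "card B = card (Edges D)"
    using infinite_arbitrarily_large[OF inf] by blast
  then obtain g :: "'e \<Rightarrow> 'l" where g: "inj_on g (Edges D)"
    using fin by (metis bij_betw_imp_inj_on finite_same_card_bij)
  let ?D = "relabel g D"
  note D1 = is_database_relabel[OF D, of g]
  have wD: "w \<in> walks D" using w by (simp add: matches_def)
  obtain U where U: "lang U = {walk_label D w}"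
    by (rule lang_singletonE)
  obtain U1 where U1: "lang U1 = {walk_label ?D w}"
    by (rule lang_singletonE)
  have wU: "w \<in> matches D U"
    using wD by (simp add: matches_def U)
  then obtain R1 where R1: "matches ?D R1 = matches D U"
    using matches_relabel[OF g fin U] by blast
  have "w \<in> S D R \<longleftrightarrow> w \<in> S D U"
    by (rule mem_singleton_iff[OF D w(1) U])
  \<comment> \<open>The databases differ but the match sets agree, and \<open>r\<close> sees only
    these.\<close>
  also have "\<dots> \<longleftrightarrow> w \<in> S ?D R1"
    by (simp add: walk_based D D1 R1)
  also have "\<dots> \<longleftrightarrow> w \<in> S ?D U1"
    using mem_singleton_iff[OF D1 _ U1] wU R1 by simp
  also have "\<dots> \<longleftrightarrow> w \<in> r {w}"
    using matches_relabel_singleton[OF g wD w(2) U1] by (simp add: walk_based D1)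
  finally show ?thesis .
qed

lemma ex_filter_based:
  assumes inf: "infinite (UNIV :: 'l set)"
  shows "\<exists>S' :: ('v, 'e, 'l) semantics. is_semantics S' \<and> filter_based S' \<and>
    (\<forall>D R w. is_database D \<and> walk_length w > 0 \<longrightarrow> (w \<in> S D R \<longleftrightarrow> w \<in> S' D R))"
proof -
  \<comment> \<open>Rejecting walks of length 0 makes \<open>S' D R\<close> a subset of
    \<open>S D R\<close>, from which it inherits finiteness.\<close>
  define f where "f w \<longleftrightarrow> walk_length w > 0 \<and> w \<in> r {w}" for w
  define S' :: "('v, 'e, 'l) semantics" where "S' D R = {w \<in> matches D R. f w}" for D R
  have sub: "S D R \<subseteq> matches D R" "finite (S D R)" if "is_database D" for D R
    using semantics that by (auto simp: is_semantics_def)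
  have iff: "w \<in> S D R \<longleftrightarrow> w \<in> S' D R" if "is_database D" "walk_length w > 0" for D R w
    using mem_iff[OF inf that(1) _ that(2)] sub[OF that(1)] that(2)
    by (auto simp: S'_def f_def)
  have S'_sub: "S' D R \<subseteq> matches D R" "S' D R \<subseteq> S D R" if "is_database D" for D R
    using iff[OF that] by (auto simp: S'_def f_def)
  have "is_semantics S'"
    using sub(2) unfolding is_semantics_def by (metis S'_sub finite_subset)
  moreover have "filter_based S'"
    unfolding filter_based_def S'_def by blast
  ultimately show ?thesis
    using iff by blast
qed

end

theorem lemma41:
  shows "(\<forall>S :: ('v :: {countable, infinite}, 'e :: {countable, infinite}, 'l :: {countable, infinite}) semantics.
            is_semantics S \<and> filter_based S \<longrightarrow> plus_compatible S) \<and>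
         (\<forall>S :: ('v, 'e, 'l) semantics.
            is_semantics S \<and> order_based S \<longrightarrow> plus_decomposable S \<and> \<not> plus_composable S) \<and>
         (\<forall>S :: ('v, 'e, 'l) semantics.
            is_semantics S \<and> walk_based S \<and> plus_compatible S \<longrightarrow>
            (\<exists>S' :: ('v, 'e, 'l) semantics.
               is_semantics S' \<and> filter_based S' \<and>
               (\<forall>D R w. is_database D \<and> walk_length w > 0 \<longrightarrow> (w \<in> S D R \<longleftrightarrow> w \<in> S' D R))))"
proof (intro conjI allI impI)
  fix S :: "('v, 'e, 'l) semantics"
  assume "is_semantics S \<and> filter_based S"
  then show "plus_compatible S"
    by (blast intro: filter_based_plus_compatible)
next
  fix S :: "('v, 'e, 'l) semantics"
  assume "is_semantics S \<and> order_based S"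
  then show "plus_decomposable S" "\<not> plus_composable S"
    by (blast intro: order_based_plus_decomposable order_based_not_plus_composable[THEN notE])+
next
  fix S :: "('v, 'e, 'l) semantics"
  assume S: "is_semantics S \<and> walk_based S \<and> plus_compatible S"
  then obtain r where "\<forall>D R. is_database D \<longrightarrow> S D R = r (matches D R)"
    unfolding walk_based_def by blast
  with S interpret plus_compatible_walk_semantics S r
    by unfold_locales auto
  show "\<exists>S' :: ('v, 'e, 'l) semantics. is_semantics S' \<and> filter_based S' \<and>
      (\<forall>D R w. is_database D \<and> walk_length w > 0 \<longrightarrow> (w \<in> S D R \<longleftrightarrow> w \<in> S' D R))"
    by (rule ex_filter_based) (rule infinite_UNIV)
qed

end
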